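(* Let $(X^o_t)_{t=1}^T$, $(X^r_t)_{t=1}^T$, $(R_t)_{t=0}^T$ be sequences with $X^o_t,X^r_t\in L^1(\mathcal F_t,\mathbb Q)$ for $t\in\{1,\dots,T\}$, $R_T=0$ and $R_t\in L^1(\mathcal F_t,\mathbb Q)$ for $t\in\{0,\dots,T-1\}$. Set $X_t:=X^o_t-X^r_t$. For $t\in\{0,\dots,T-1\}$ consider the optimal stopping values $$\text{(a)}\quad C_t=\operatorname*{ess\,sup}_{\tau\in\mathcal S_{t+1,T+1}}\mathbb E^{\mathbb Q}_t\Big[\sum_{s=t+1}^{\tau-1}(R_{s-1}-R_s-X_s)\Big],\qquad \text{(b)}\quad V_t=\operatorname*{ess\,inf}_{\tau\in\mathcal S_{t+1,T+1}}\mathbb E^{\mathbb Q}_t\Big[\sum_{s=t+1}^{\tau-1}X_s+R_{\tau-1}\Big],$$ with $C_T:=0$, $V_T:=0$, and the backward recursions, for $t\in\{0,\dots,T-1\}$, $$\text{(c)}\quad C_t=\mathbb E^{\mathbb Q}_t\big[(R_t-X_{t+1}-V_{t+1})_+\big],\ C_T=0,\qquad \text{(d)}\quad V_t=R_t-\mathbb E^{\mathbb Q}_t\big[(R_t-X_{t+1}-V_{t+1})_+\big],\ V_T=0.$$ (i) If $(C_t)_{t=0}^T$ and $(V_t)_{t=0}^T$ are defined by (a) and (b) (with $C_T=V_T=0$), then they satisfy (c) and (d). (ii) The stopping times $(\tau^*_t)_{t=0}^{T-1}$ given by $$\tau^*_t=\inf\{s\in\{t+1,\dots,T\}:R_{s-1}-X_s-V_s<0\}\wedge(T+1)$$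 are optimal in (a) and (b), i.e. for each $t$ the essential supremum in (a) and the essential infimum in (b) are attained at $\tau=\tau^*_t$. (iii) If $(C_t)_{t=0}^T$ and $(V_t)_{t=0}^T$ are defined by (c) and (d), then, for $t\in\{0,\dots,T-1\}$, $C_t$ and $V_t$ are given by (a) and (b).
   Context: $T\ge1$ is an integer; $(\Omega,\mathcal F,(\mathcal F_t)_{t=0}^T,\mathbb P)$ is a filtered probability space with $\mathcal F_0=\{\emptyset,\Omega\}\subseteq\dots\subseteq\mathcal F_T=\mathcal F$. $(D_t)_{t=0}^T$ is a strictly positive $\mathbb P$-martingale with $\mathbb E^{\mathbb P}[D_T]=1$, and $\mathbb Q$ is the equivalent probability measure with $D_t=d\mathbb Q/d\mathbb P|_{\mathcal F_t}$. $\mathbb E^{\mathbb Q}_t$ denotes conditional expectation under $\mathbb Q$ given $\mathcal F_t$. $\mathcal S_{t+1,T+1}$ is the set of stopping times with respect to $(\mathcal F_t)_{t=0}^T$ taking values in $\{t+1,\dots,T+1\}$ (the event $\{\tau=T+1\}$ meaning no stopping at any of the times up to $T$). Essential suprema/infima are with respect to $\mathbb Q$. Equalities and inequalities between random variables are almost sure. Conventions: $\sum_{l=k}^{k-1}:=0$, $\inf\emptyset:=+\infty$, $(x)_+:=\max(0,x)$, $a\wedge b:=\min(a,b)$. *)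

theory Defs
  imports "HOL-Probability.Probability"
begin

text \<open>
  Only the \<open>\<sigma>\<close>-algebras \<open>F 0, \<dots>, F T\<close> matter; \<open>F t\<close> is unconstrained for \<open>t > T\<close>.
\<close>

locale filtered_prob_space = prob_space P
  for P :: "'a measure" +
  fixes F :: "nat \<Rightarrow> 'a measure" and T :: nat
  assumes subalgebra_F: "\<And>t. t \<le> T \<Longrightarrow> subalgebra P (F t)"
    and sets_F_mono: "\<And>s t. s \<le> t \<Longrightarrow> t \<le> T \<Longrightarrow> sets (F s) \<subseteq> sets (F t)"
    and sets_F_0: "sets (F 0) = {{}, space P}"
    and sets_F_T: "sets (F T) = sets P"

definition adapted :: "(nat \<Rightarrow> 'a measure) \<Rightarrow> nat \<Rightarrow> (nat \<Rightarrow> 'a \<Rightarrow> real) \<Rightarrow> bool" where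
  "adapted F T Y \<longleftrightarrow> (\<forall>t\<le>T. Y t \<in> borel_measurable (F t))"

definition L1 :: "'a measure \<Rightarrow> 'a measure \<Rightarrow> ('a \<Rightarrow> real) set" where
  "L1 N G = {f. integrable (restr_to_subalg N G) f}"

definition is_martingale ::
  "'a measure \<Rightarrow> (nat \<Rightarrow> 'a measure) \<Rightarrow> nat \<Rightarrow> (nat \<Rightarrow> 'a \<Rightarrow> real) \<Rightarrow> bool" where
  "is_martingale N F T Y \<longleftrightarrow>
     (\<forall>t\<le>T. Y t \<in> L1 N (F t)) \<and>
     (\<forall>s t. s \<le> t \<longrightarrow> t \<le> T \<longrightarrow> (AE \<omega> in N. real_cond_exp N (F s) (Y t) \<omega> = Y s \<omega>))"

text \<open>
  \<^const>\<open>esssup\<close> is the essential supremum of a single function. Here \<open>g\<close> is a version of the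
  essential supremum (infimum) of the family \<open>(f i)\<^sub>i\<^sub>\<in>\<^sub>I\<close> of random variables, that is, an almost
  surely smallest (largest) extended real random variable almost surely bounding each \<open>f i\<close>.
\<close>

definition is_ess_sup ::
  "'a measure \<Rightarrow> 'i set \<Rightarrow> ('i \<Rightarrow> 'a \<Rightarrow> ereal) \<Rightarrow> ('a \<Rightarrow> ereal) \<Rightarrow> bool" where
  "is_ess_sup N I f g \<longleftrightarrow>
     g \<in> borel_measurable N \<and>
     (\<forall>i\<in>I. AE \<omega> in N. f i \<omega> \<le> g \<omega>) \<and>
     (\<forall>h\<in>borel_measurable N. (\<forall>i\<in>I. AE \<omega> in N. f i \<omega> \<le> h \<omega>) \<longrightarrow> (AE \<omega> in N. g \<omega> \<le> h \<omega>))"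

definition is_ess_inf ::
  "'a measure \<Rightarrow> 'i set \<Rightarrow> ('i \<Rightarrow> 'a \<Rightarrow> ereal) \<Rightarrow> ('a \<Rightarrow> ereal) \<Rightarrow> bool" where
  "is_ess_inf N I f g \<longleftrightarrow>
     g \<in> borel_measurable N \<and>
     (\<forall>i\<in>I. AE \<omega> in N. g \<omega> \<le> f i \<omega>) \<and>
     (\<forall>h\<in>borel_measurable N. (\<forall>i\<in>I. AE \<omega> in N. h \<omega> \<le> f i \<omega>) \<longrightarrow> (AE \<omega> in N. h \<omega> \<le> g \<omega>))"

text \<open>
  For \<open>b = T + 1\<close> the condition in \<^const>\<open>stopping_time\<close> at times \<open>t \<ge> T + 1\<close> holds trivially, so
  these are the stopping times with respect to \<open>F 0, \<dots>, F T\<close> (up to the irrelevant values of \<open>\<tau>\<close>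
  outside \<open>space N\<close>).
\<close>

definition stopping_times ::
  "'a measure \<Rightarrow> (nat \<Rightarrow> 'a measure) \<Rightarrow> nat \<Rightarrow> nat \<Rightarrow> ('a \<Rightarrow> nat) set" where
  "stopping_times N F a b = {\<tau>. stopping_time F \<tau> \<and> (\<forall>\<omega>\<in>space N. \<tau> \<omega> \<in> {a..b})}"

definition stopped_gain ::
  "(nat \<Rightarrow> 'a \<Rightarrow> real) \<Rightarrow> (nat \<Rightarrow> 'a \<Rightarrow> real) \<Rightarrow> nat \<Rightarrow> ('a \<Rightarrow> nat) \<Rightarrow> 'a \<Rightarrow> real" where
  "stopped_gain R X t \<tau> \<omega> = (\<Sum>s = t + 1..\<tau> \<omega> - 1. R (s - 1) \<omega> - R s \<omega> - X s \<omega>)"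

definition stopped_cost ::
  "(nat \<Rightarrow> 'a \<Rightarrow> real) \<Rightarrow> (nat \<Rightarrow> 'a \<Rightarrow> real) \<Rightarrow> nat \<Rightarrow> ('a \<Rightarrow> nat) \<Rightarrow> 'a \<Rightarrow> real" where
  "stopped_cost R X t \<tau> \<omega> = (\<Sum>s = t + 1..\<tau> \<omega> - 1. X s \<omega>) + R (\<tau> \<omega> - 1) \<omega>"

text \<open>
  Both predicates below ask for \<open>F t\<close>-measurable versions of the values at time \<open>t\<close>, which are
  otherwise determined only up to null sets.
\<close>

definition stopping_values ::
  "'a measure \<Rightarrow> (nat \<Rightarrow> 'a measure) \<Rightarrow> nat \<Rightarrow> (nat \<Rightarrow> 'a \<Rightarrow> real) \<Rightarrow> (nat \<Rightarrow> 'a \<Rightarrow> real) \<Rightarrow>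
   (nat \<Rightarrow> 'a \<Rightarrow> real) \<Rightarrow> (nat \<Rightarrow> 'a \<Rightarrow> real) \<Rightarrow> bool" where
  "stopping_values Q F T R X C V \<longleftrightarrow>
     adapted F T C \<and> adapted F T V \<and>
     (AE \<omega> in Q. C T \<omega> = 0) \<and> (AE \<omega> in Q. V T \<omega> = 0) \<and>
     (\<forall>t<T.
        is_ess_sup Q (stopping_times Q F (t + 1) (T + 1))
          (\<lambda>\<tau> \<omega>. ereal (real_cond_exp Q (F t) (stopped_gain R X t \<tau>) \<omega>)) (\<lambda>\<omega>. ereal (C t \<omega>)) \<and>
        is_ess_inf Q (stopping_times Q F (t + 1) (T + 1))
          (\<lambda>\<tau> \<omega>. ereal (real_cond_exp Q (F t) (stopped_cost R X t \<tau>) \<omega>)) (\<lambda>\<omega>. ereal (V t \<omega>)))"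

definition recursive_values ::
  "'a measure \<Rightarrow> (nat \<Rightarrow> 'a measure) \<Rightarrow> nat \<Rightarrow> (nat \<Rightarrow> 'a \<Rightarrow> real) \<Rightarrow> (nat \<Rightarrow> 'a \<Rightarrow> real) \<Rightarrow>
   (nat \<Rightarrow> 'a \<Rightarrow> real) \<Rightarrow> (nat \<Rightarrow> 'a \<Rightarrow> real) \<Rightarrow> bool" where
  "recursive_values Q F T R X C V \<longleftrightarrow>
     adapted F T C \<and> adapted F T V \<and>
     (AE \<omega> in Q. C T \<omega> = 0) \<and> (AE \<omega> in Q. V T \<omega> = 0) \<and>
     (\<forall>t<T.
        (AE \<omega> in Q. C t \<omega> =
           real_cond_exp Q (F t) (\<lambda>\<omega>. max 0 (R t \<omega> - X (t + 1) \<omega> - V (t + 1) \<omega>)) \<omega>) \<and>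
        (AE \<omega> in Q. V t \<omega> =
           R t \<omega> - real_cond_exp Q (F t) (\<lambda>\<omega>. max 0 (R t \<omega> - X (t + 1) \<omega> - V (t + 1) \<omega>)) \<omega>))"

text \<open>Inserting \<open>T + 1\<close> into the set combines \<open>inf \<emptyset> = \<infinity>\<close> with the minimum with \<open>T + 1\<close>.\<close>

definition optimal_time ::
  "nat \<Rightarrow> (nat \<Rightarrow> 'a \<Rightarrow> real) \<Rightarrow> (nat \<Rightarrow> 'a \<Rightarrow> real) \<Rightarrow> (nat \<Rightarrow> 'a \<Rightarrow> real) \<Rightarrow> nat \<Rightarrow> 'a \<Rightarrow> nat" where
  "optimal_time T R X V t \<omega> =
     Min (insert (T + 1) {s \<in> {t + 1..T}. R (s - 1) \<omega> - X s \<omega> - V s \<omega> < 0})"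

end

theory Submission
  imports Defs
begin

text \<open>
  Since the gain and the cost of a stopping time sum to \<open>R t\<close>, everything reduces to \<open>V\<close>.
  Conditioning on \<open>F (t + 1)\<close> first, the cost of \<open>\<tau>\<close> becomes \<open>R t\<close> where \<open>\<tau> = t + 1\<close>, and \<open>X (t + 1)\<close>
  plus the conditional cost of continuing elsewhere. The recursion says that \<open>V t\<close> is the conditional
  expectation of \<open>min (R t) (X (t + 1) + V (t + 1))\<close>, so by backward induction \<open>V t\<close> bounds all
  conditional costs from below, with equality when one stops exactly where the first entry is the
  smaller one. Hence solutions of the recursion are stopping values; as the recursion has a solution
  and essential suprema and infima are almost surely unique, the converse follows.
\<close>

section \<open>Essential suprema and infima: uniqueness and attainment\<close>

lemma is_ess_sup_unique:
  assumes "is_ess_sup N I f g" "is_ess_sup N I f h"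
  shows "AE \<omega> in N. g \<omega> = h \<omega>"
proof -
  have "AE \<omega> in N. g \<omega> \<le> h \<omega>" "AE \<omega> in N. h \<omega> \<le> g \<omega>"
    using assms unfolding is_ess_sup_def by blast+
  then show ?thesis by eventually_elim auto
qed

lemma is_ess_inf_unique:
  assumes "is_ess_inf N I f g" "is_ess_inf N I f h"
  shows "AE \<omega> in N. g \<omega> = h \<omega>"
proof -
  have "AE \<omega> in N. g \<omega> \<le> h \<omega>" "AE \<omega> in N. h \<omega> \<le> g \<omega>"
    using assms unfolding is_ess_inf_def by blast+
  then show ?thesis by eventually_elim auto
qed

text \<open>A bound that agrees almost surely with one member of the family lies below every other
  bound. Exhibiting an optimal time therefore yields the essential supremum directly, without
  passing to countable subfamilies.\<close>

lemma is_ess_sup_attained: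
  assumes "g \<in> borel_measurable N" "\<And>i. i \<in> I \<Longrightarrow> AE \<omega> in N. f i \<omega> \<le> g \<omega>"
    and "i0 \<in> I" "AE \<omega> in N. g \<omega> = f i0 \<omega>"
  shows "is_ess_sup N I f g"
  unfolding is_ess_sup_def
proof (intro conjI ballI impI)
  fix h assume "\<forall>i\<in>I. AE \<omega> in N. f i \<omega> \<le> h \<omega>"
  with assms(3) have "AE \<omega> in N. f i0 \<omega> \<le> h \<omega>" by blast
  with assms(4) show "AE \<omega> in N. g \<omega> \<le> h \<omega>" by eventually_elim simp
qed (use assms in auto)

lemma is_ess_inf_attained:
  assumes "g \<in> borel_measurable N" "\<And>i. i \<in> I \<Longrightarrow> AE \<omega> in N. g \<omega> \<le> f i \<omega>"
    and "i0 \<in> I" "AE \<omega> in N. g \<omega> = f i0 \<omega>"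
  shows "is_ess_inf N I f g"
  unfolding is_ess_inf_def
proof (intro conjI ballI impI)
  fix h assume "\<forall>i\<in>I. AE \<omega> in N. h \<omega> \<le> f i \<omega>"
  with assms(3) have "AE \<omega> in N. h \<omega> \<le> f i0 \<omega>" by blast
  with assms(4) show "AE \<omega> in N. h \<omega> \<le> g \<omega>" by eventually_elim simp
qed (use assms in auto)

section \<open>Integrability on a sub-\<sigma>-algebra, and pathwise identities\<close>

lemma L1_iff:
  assumes "subalgebra N G"
  shows "f \<in> L1 N G \<longleftrightarrow> f \<in> borel_measurable G \<and> integrable N f"
proof
  assume f: "f \<in> L1 N G"
  then have "f \<in> borel_measurable (restr_to_subalg N G)"
    by (auto simp: L1_def)
  with f show "f \<in> borel_measurable G \<and> integrable N f"
    using measurable_in_subalg'[OF assms] integrable_from_subalg[OF assms] by (auto simp: L1_def)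
qed (use integrable_in_subalg[OF assms] in \<open>auto simp: L1_def\<close>)

text \<open>The increments of \<open>R\<close> telescope to \<open>R t - R (\<tau> - 1)\<close>.
  Large gains thus correspond to small costs, which ties the two stopping problems together.\<close>

lemma stopped_gain_eq:
  assumes "t + 1 \<le> \<tau> \<omega>"
  shows "stopped_gain R X t \<tau> \<omega> = R t \<omega> - stopped_cost R X t \<tau> \<omega>"
proof -
  \<comment> \<open>The sum is indexed by its length \<open>n\<close>, which allows induction. The
    assumption \<open>t + 1 \<le> \<tau> \<omega>\<close> makes the truncated subtraction in
    \<open>n = \<tau> \<omega> - 1 - t\<close> harmless.\<close>
  have "(\<Sum>s = t + 1..t + n. R (s - 1) \<omega> - R s \<omega> - X s \<omega>) =
      R t \<omega> - R (t + n) \<omega> - (\<Sum>s = t + 1..t + n. X s \<omega>)" for n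
    by (induction n) auto
  from this[of "\<tau> \<omega> - 1 - t"] assms show ?thesis
    by (simp add: stopped_gain_def stopped_cost_def)
qed

text \<open>Stopping at \<open>t + 1\<close> leaves an empty sum and pays \<open>R t\<close>;
  otherwise the first summand splits off and the problem restarts one date later. Agreement of
  \<open>\<sigma>\<close> with \<open>\<tau>\<close> is asked for only in the second case, so
  \<open>\<sigma>\<close> can be chosen with all its values beyond \<open>t + 1\<close>.\<close>

lemma stopped_cost_step:
  assumes "t + 1 \<le> \<tau> \<omega>" "\<tau> \<omega> \<noteq> t + 1 \<Longrightarrow> \<sigma> \<omega> = \<tau> \<omega>"
  shows "stopped_cost R X t \<tau> \<omega> =
    (if \<tau> \<omega> = t + 1 then R t \<omega> else X (t + 1) \<omega> + stopped_cost R X (t + 1) \<sigma> \<omega>)"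
proof (cases "\<tau> \<omega> = t + 1")
  case False
  with assms have "t + 1 \<le> \<tau> \<omega> - 1" by linarith
  then have "(\<Sum>s = t + 1..\<tau> \<omega> - 1. X s \<omega>) = X (t + 1) \<omega> + (\<Sum>s = t + 1 + 1..\<tau> \<omega> - 1. X s \<omega>)"
    by (simp add: sum.atLeast_Suc_atMost)
  with False assms show ?thesis by (simp add: stopped_cost_def)
qed (simp add: stopped_cost_def)

lemma optimal_time_bounds:
  assumes "t \<le> T"
  shows "optimal_time T R X V t \<omega> \<in> {t + 1..T + 1}"
  using assms by (auto simp: optimal_time_def)

text \<open>Passing from \<open>t + 1\<close> to \<open>t\<close> adds at most the candidate
  \<open>t + 1\<close>, which is smaller than all others and hence becomes the minimum as soon as it
  qualifies.\<close>

lemma optimal_time_step: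
  assumes "t < T"
  shows "optimal_time T R X V t \<omega> =
    (if R t \<omega> - X (t + 1) \<omega> - V (t + 1) \<omega> < 0 then t + 1 else optimal_time T R X V (t + 1) \<omega>)"
proof -
  let ?S = "\<lambda>t. {s \<in> {t + 1..T}. R (s - 1) \<omega> - X s \<omega> - V s \<omega> < 0}"
  have "{t + 1..T} = insert (t + 1) {t + 1 + 1..T}" using assms by auto
  then have S: "?S t = (if R t \<omega> - X (t + 1) \<omega> - V (t + 1) \<omega> < 0
      then insert (t + 1) (?S (t + 1)) else ?S (t + 1))"
    by auto
  show ?thesis
  proof (cases "R t \<omega> - X (t + 1) \<omega> - V (t + 1) \<omega> < 0")
    case True
    then show ?thesis
      using assms unfolding optimal_time_def by (auto intro!: Min_eqI)
  next
    case False
    with S show ?thesis unfolding optimal_time_def by simp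
  qed
qed

lemma integrable_if:
  fixes f g :: "'a \<Rightarrow> real"
  assumes "integrable M f" "integrable M g" and [measurable]: "Measurable.pred M P"
  shows "integrable M (\<lambda>\<omega>. if P \<omega> then f \<omega> else g \<omega>)"
proof (rule Bochner_Integration.integrable_bound)
  show "integrable M (\<lambda>\<omega>. \<bar>f \<omega>\<bar> + \<bar>g \<omega>\<bar>)" using assms by simp
qed (use assms in auto)

text \<open>The argument takes place under \<open>Q\<close> alone. The density process serves to
  make \<open>Q\<close> a probability measure, and \<open>theorem1\<close> discharges the
  assumptions made here.\<close>

locale optimal_stopping = prob_space Q
  for Q :: "'a measure" +
  fixes F :: "nat \<Rightarrow> 'a measure" and T :: nat and R X :: "nat \<Rightarrow> 'a \<Rightarrow> real"
  assumes subalgebra_F: "\<And>t. t \<le> T \<Longrightarrow> subalgebra Q (F t)"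
    and sets_F_mono: "\<And>s t. s \<le> t \<Longrightarrow> t \<le> T \<Longrightarrow> sets (F s) \<subseteq> sets (F t)"
    and X_L1: "\<And>t. t \<in> {1..T} \<Longrightarrow> X t \<in> L1 Q (F t)"
    and R_L1: "\<And>t. t \<le> T \<Longrightarrow> R t \<in> L1 Q (F t)"
    and R_T: "AE \<omega> in Q. R T \<omega> = 0"
begin

abbreviation E :: "nat \<Rightarrow> ('a \<Rightarrow> real) \<Rightarrow> 'a \<Rightarrow> real"
  where "E t \<equiv> real_cond_exp Q (F t)"

section \<open>Filtration, measurability and stopping times under \<open>Q\<close>\<close>

lemma sigma_finite_subalgebra_F:
  assumes "t \<le> T"
  shows "sigma_finite_subalgebra Q (F t)"
  using subalgebra_F[OF assms] finite_measure_axioms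
  by (intro finite_measure_subalgebra_is_sigma_finite)
     (simp add: finite_measure_subalgebra_def finite_measure_subalgebra_axioms_def)

lemma space_F: "t \<le> T \<Longrightarrow> space (F t) = space Q"
  using subalgebra_F by (simp add: subalgebra_def)

lemma subalgebra_F_mono: "s \<le> t \<Longrightarrow> t \<le> T \<Longrightarrow> subalgebra (F t) (F s)"
  using sets_F_mono[of s t] space_F[of s] space_F[of t] by (simp add: subalgebra_def)

lemma measurable_F_mono: "f \<in> measurable (F s) N \<Longrightarrow> s \<le> t \<Longrightarrow> t \<le> T \<Longrightarrow> f \<in> measurable (F t) N"
  using measurable_from_subalg[OF subalgebra_F_mono] by blast

lemma measurable_F_Q: "f \<in> measurable (F t) N \<Longrightarrow> t \<le> T \<Longrightarrow> f \<in> measurable Q N"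
  using measurable_from_subalg[OF subalgebra_F] by blast

lemma R_measurable: "t \<le> T \<Longrightarrow> R t \<in> borel_measurable (F t)"
  and R_integrable: "t \<le> T \<Longrightarrow> integrable Q (R t)"
  using R_L1 L1_iff[OF subalgebra_F] by auto

lemma X_measurable: "t \<in> {1..T} \<Longrightarrow> X t \<in> borel_measurable (F t)"
  and X_integrable: "t \<in> {1..T} \<Longrightarrow> integrable Q (X t)"
  using X_L1 L1_iff[OF subalgebra_F] by auto

lemma stopping_time_pred:
  assumes "\<tau> \<in> stopping_times Q F a b" "s \<le> t" "t \<le> T"
  shows "Measurable.pred (F t) (\<lambda>\<omega>. \<tau> \<omega> \<le> s)"
  using assms by (auto simp: stopping_times_def intro: stopping_timeD measurable_F_mono)

text \<open>As \<open>t\<close> is the least possible value of \<open>\<tau>\<close>, the events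
  \<open>\<tau> \<le> t\<close> and \<open>\<tau> = t\<close> coincide on the space.\<close>

lemma stopping_times_pred_eq:
  assumes "\<tau> \<in> stopping_times Q F t b" "t \<le> T"
  shows "Measurable.pred (F t) (\<lambda>\<omega>. \<tau> \<omega> = t)"
proof -
  have "Measurable.pred (F t) (\<lambda>\<omega>. \<tau> \<omega> \<le> t)"
    using assms stopping_time_pred by blast
  moreover have "\<And>\<omega>. \<omega> \<in> space (F t) \<Longrightarrow> \<tau> \<omega> \<le> t \<longleftrightarrow> \<tau> \<omega> = t"
    using assms by (auto simp: stopping_times_def space_F intro: antisym)
  ultimately show ?thesis by (simp cong: measurable_cong)
qed

section \<open>Costs of stopping times and one-step conditioning\<close>

lemma stopping_times_max:
  assumes "\<tau> \<in> stopping_times Q F a b" "c \<le> b"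
  shows "(\<lambda>\<omega>. max (\<tau> \<omega>) c) \<in> stopping_times Q F c b"
  using assms stopping_time_max[OF _ stopping_time_const] by (auto simp: stopping_times_def)

text \<open>The sum has a random range. Unfolding it one date at a time presents the cost as a
  measurable case split between integrable variables, starting from \<open>R T\<close> at the last
  date.\<close>

lemma integrable_stopped_cost:
  assumes "t \<le> T" "\<tau> \<in> stopping_times Q F (t + 1) (T + 1)"
  shows "integrable Q (stopped_cost R X t \<tau>)"
  using assms
proof (induction t arbitrary: \<tau> rule: inc_induct)
  case base
  then have "\<And>\<omega>. \<omega> \<in> space Q \<Longrightarrow> stopped_cost R X T \<tau> \<omega> = R T \<omega>"
    by (auto simp: stopping_times_def stopped_cost_def)
  then show ?case
    using R_integrable[of T] by (simp cong: Bochner_Integration.integrable_cong)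
next
  case (step t)
  \<comment> \<open>Taking the maximum with \<open>t + 2\<close> moves \<open>\<tau>\<close> into
    the range of the next date, to which the induction hypothesis applies. Where
    \<open>\<tau>\<close> exceeds \<open>t + 1\<close> nothing changes.\<close>
  let ?\<sigma> = "\<lambda>\<omega>. max (\<tau> \<omega>) (t + 2)"
  have \<sigma>: "?\<sigma> \<in> stopping_times Q F (Suc t + 1) (T + 1)"
    using stopping_times_max[OF step.prems, of "t + 2"] step.hyps by simp
  have "\<And>\<omega>. \<omega> \<in> space Q \<Longrightarrow> stopped_cost R X t \<tau> \<omega> =
      (if \<tau> \<omega> = t + 1 then R t \<omega> else X (t + 1) \<omega> + stopped_cost R X (t + 1) ?\<sigma> \<omega>)"
    using step.prems by (intro stopped_cost_step) (force simp: stopping_times_def)+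
  moreover have "integrable Q (\<lambda>\<omega>. if \<tau> \<omega> = t + 1 then R t \<omega>
      else X (t + 1) \<omega> + stopped_cost R X (t + 1) ?\<sigma> \<omega>)"
    using step.hyps step.IH[OF \<sigma>] stopping_times_pred_eq[OF step.prems]
    by (intro integrable_if Bochner_Integration.integrable_add)
       (auto intro: R_integrable X_integrable measurable_F_Q[of _ "t + 1"])
  ultimately show ?case by (simp cong: Bochner_Integration.integrable_cong)
qed

text \<open>Tower property through \<open>F (t + 1)\<close>: the decision at \<open>t + 1\<close>,
  \<open>R t\<close> and \<open>X (t + 1)\<close> are already known there, so the inner conditioning
  acts only on the later cost. Keeping \<open>\<sigma>\<close> general serves both an arbitrary
  \<open>\<tau>\<close>, shifted by a maximum, and the optimal times.\<close>

lemma cond_exp_stopped_cost_step: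
  assumes t: "t < T"
    and \<tau>: "\<tau> \<in> stopping_times Q F (t + 1) (T + 1)"
    and \<sigma>: "\<sigma> \<in> stopping_times Q F (t + 2) (T + 1)"
    and eq: "\<forall>\<omega>\<in>space Q. \<tau> \<omega> \<noteq> t + 1 \<longrightarrow> \<sigma> \<omega> = \<tau> \<omega>"
  shows "AE \<omega> in Q. E t (stopped_cost R X t \<tau>) \<omega> =
      E t (\<lambda>\<omega>. if \<tau> \<omega> = t + 1 then R t \<omega>
        else X (t + 1) \<omega> + E (t + 1) (stopped_cost R X (t + 1) \<sigma>) \<omega>) \<omega>"
proof -
  interpret t: sigma_finite_subalgebra Q "F t"
    using t sigma_finite_subalgebra_F by simp
  interpret t1: sigma_finite_subalgebra Q "F (t + 1)"
    using t sigma_finite_subalgebra_F by simp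
  let ?h = "\<lambda>\<omega>. if \<tau> \<omega> = t + 1 then R t \<omega> else X (t + 1) \<omega>"
  \<comment> \<open>The case split is written as a sum with a 0/1 factor, so that the
    \<open>F (t + 1)\<close>-measurable factor can be pulled out of the conditional
    expectation.\<close>
  let ?i = "\<lambda>\<omega>. if \<tau> \<omega> = t + 1 then 0 else 1 :: real"
  let ?c = "stopped_cost R X (t + 1) \<sigma>"
  have pred[measurable]: "Measurable.pred (F (t + 1)) (\<lambda>\<omega>. \<tau> \<omega> = t + 1)"
    using stopping_times_pred_eq[OF \<tau>] t by simp
  have predQ[measurable]: "Measurable.pred Q (\<lambda>\<omega>. \<tau> \<omega> = t + 1)"
    by (rule measurable_F_Q[OF pred]) (use t in simp)
  have [measurable]: "R t \<in> borel_measurable (F (t + 1))"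
    using measurable_F_mono[OF R_measurable, of t "t + 1"] t by simp
  have [measurable]: "X (t + 1) \<in> borel_measurable (F (t + 1))"
    using X_measurable t by simp
  have h_int: "integrable Q ?h"
    using t by (intro integrable_if R_integrable X_integrable predQ) auto
  have c_int: "integrable Q ?c"
    using integrable_stopped_cost[of "t + 1" \<sigma>] \<sigma> t by simp
  have ic_int: "integrable Q (\<lambda>\<omega>. ?i \<omega> * ?c \<omega>)"
    using integrable_if[OF integrable_zero c_int predQ]
    by (simp add: if_distrib[of "\<lambda>x. x * _"] cong: if_cong)
  have cost: "\<And>\<omega>. \<omega> \<in> space Q \<Longrightarrow> stopped_cost R X t \<tau> \<omega> = ?h \<omega> + ?i \<omega> * ?c \<omega>"
    using \<tau> eq stopped_cost_step[of t \<tau> _ \<sigma> R X] by (auto simp: stopping_times_def)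
  have cost_int: "integrable Q (stopped_cost R X t \<tau>)"
    using integrable_stopped_cost[OF _ \<tau>] t by simp
  have "AE \<omega> in Q. E (t + 1) (stopped_cost R X t \<tau>) \<omega> = E (t + 1) (\<lambda>\<omega>. ?h \<omega> + ?i \<omega> * ?c \<omega>) \<omega>"
    using cost cost_int h_int ic_int by (intro t1.real_cond_exp_cong AE_I2) auto
  moreover have "AE \<omega> in Q. E (t + 1) (\<lambda>\<omega>. ?h \<omega> + ?i \<omega> * ?c \<omega>) \<omega> =
      E (t + 1) ?h \<omega> + E (t + 1) (\<lambda>\<omega>. ?i \<omega> * ?c \<omega>) \<omega>"
    by (rule t1.real_cond_exp_add[OF h_int ic_int])
  moreover have "AE \<omega> in Q. E (t + 1) ?h \<omega> = ?h \<omega>"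
    by (rule t1.real_cond_exp_F_meas[OF h_int]) measurable
  moreover have "AE \<omega> in Q. E (t + 1) (\<lambda>\<omega>. ?i \<omega> * ?c \<omega>) \<omega> = ?i \<omega> * E (t + 1) ?c \<omega>"
    by (rule t1.real_cond_exp_mult[OF _ borel_measurable_integrable[OF c_int] ic_int]) measurable
  ultimately have inner: "AE \<omega> in Q. E (t + 1) (stopped_cost R X t \<tau>) \<omega> =
      (if \<tau> \<omega> = t + 1 then R t \<omega> else X (t + 1) \<omega> + E (t + 1) ?c \<omega>)"
    by eventually_elim auto
  have [measurable]: "R t \<in> borel_measurable Q" "X (t + 1) \<in> borel_measurable Q"
    using R_integrable X_integrable t by auto
  have "AE \<omega> in Q. E t (E (t + 1) (stopped_cost R X t \<tau>)) \<omega> =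
      E t (\<lambda>\<omega>. if \<tau> \<omega> = t + 1 then R t \<omega> else X (t + 1) \<omega> + E (t + 1) ?c \<omega>) \<omega>"
    by (intro t.real_cond_exp_cong inner) measurable
  moreover have "AE \<omega> in Q. E t (E (t + 1) (stopped_cost R X t \<tau>)) \<omega> = E t (stopped_cost R X t \<tau>) \<omega>"
    using t cost_int
    by (intro t.real_cond_exp_nested_subalg subalgebra_F subalgebra_F_mono) auto
  ultimately show ?thesis by eventually_elim simp
qed

text \<open>Whether the strict inequality has occurred by \<open>u \<le> T\<close> depends only on
  data known at \<open>u\<close>. For \<open>u > T\<close> the event is the whole space, because the
  time never exceeds \<open>T + 1\<close>.\<close>

lemma optimal_time_stopping:
  assumes V: "adapted F T V" and t: "t \<le> T"
  shows "optimal_time T R X V t \<in> stopping_times Q F (t + 1) (T + 1)"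
proof -
  have "Measurable.pred (F u) (\<lambda>\<omega>. optimal_time T R X V t \<omega> \<le> u)" for u
  proof (cases "u \<le> T")
    case True
    have [measurable]: "Measurable.pred (F u) (\<lambda>\<omega>. R (s - 1) \<omega> - X s \<omega> - V s \<omega> < 0)"
      if "s \<in> {t + 1..u}" for s
    proof -
      have [measurable]: "R (s - 1) \<in> borel_measurable (F u)" "X s \<in> borel_measurable (F u)"
          "V s \<in> borel_measurable (F u)"
        using that True V unfolding adapted_def
        by (auto intro: measurable_F_mono[OF R_measurable] measurable_F_mono[OF X_measurable]
            measurable_F_mono[of "V s" s])
      show ?thesis by measurable
    qed
    have "Measurable.pred (F u) (\<lambda>\<omega>. \<exists>s\<in>{t + 1..u}. R (s - 1) \<omega> - X s \<omega> - V s \<omega> < 0)"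
      by measurable
    \<comment> \<open>As \<open>u \<le> T\<close>, the inserted element \<open>T + 1\<close> is
      larger than \<open>u\<close> and cannot witness the left side.\<close>
    moreover have "optimal_time T R X V t \<omega> \<le> u \<longleftrightarrow>
        (\<exists>s\<in>{t + 1..u}. R (s - 1) \<omega> - X s \<omega> - V s \<omega> < 0)" for \<omega>
      using True by (auto simp: optimal_time_def Min_le_iff)
    ultimately show ?thesis by simp
  next
    case False
    then have "optimal_time T R X V t \<omega> \<le> u" for \<omega>
      using optimal_time_bounds[OF t, of R X V \<omega>] by auto
    then show ?thesis by simp
  qed
  then show ?thesis
    using optimal_time_bounds[OF t, of R X V] by (auto simp: stopping_times_def stopping_time_def)
qed

section \<open>Solutions of the recursion: lower bound and optimal time for the cost\<close>

lemma recursive_values_integrable: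
  assumes rec: "recursive_values Q F T R X C V" and t: "t \<le> T"
  shows "integrable Q (V t)"
  using t
\<comment> \<open>The recursion prescribes adapted versions only, so integrability is derived
  backwards from the terminal value 0. The linearity and monotonicity of conditional expectation
  used later rest on it.\<close>
proof (induction t rule: inc_induct)
  case base
  have [measurable]: "V T \<in> borel_measurable Q"
    using rec measurable_F_Q[of "V T" T] by (auto simp: recursive_values_def adapted_def)
  have "AE \<omega> in Q. V T \<omega> = 0" using rec by (simp add: recursive_values_def)
  then have "integrable Q (V T) \<longleftrightarrow> integrable Q (\<lambda>_. 0 :: real)"
    by (intro integrable_cong_AE) auto
  then show ?case by simp
next
  case (step t)
  interpret t: sigma_finite_subalgebra Q "F t"
    using step.hyps sigma_finite_subalgebra_F by simp
  let ?Z = "\<lambda>\<omega>. max 0 (R t \<omega> - X (t + 1) \<omega> - V (t + 1) \<omega>)"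
  have Z: "integrable Q ?Z"
    using step R_integrable[of t] X_integrable[of "t + 1"] by simp
  have [measurable]: "V t \<in> borel_measurable Q" "R t \<in> borel_measurable Q"
    using rec step.hyps measurable_F_Q[of "V t" t] R_integrable[of t]
    by (auto simp: recursive_values_def adapted_def)
  have "AE \<omega> in Q. V t \<omega> = R t \<omega> - E t ?Z \<omega>"
    using rec step.hyps by (auto simp: recursive_values_def)
  then have "integrable Q (V t) \<longleftrightarrow> integrable Q (\<lambda>\<omega>. R t \<omega> - E t ?Z \<omega>)"
    by (intro integrable_cong_AE) auto
  then show ?case
    using step.hyps R_integrable[of t] t.real_cond_exp_int(1)[OF Z] by simp
qed

text \<open>Pointwise \<open>r - max 0 (r - y) = min r y\<close>, and \<open>R t\<close>, being
  known at \<open>t\<close>, may be moved inside the conditional expectation.\<close>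

lemma recursive_values_min:
  assumes rec: "recursive_values Q F T R X C V" and t: "t < T"
  shows "AE \<omega> in Q. V t \<omega> = E t (\<lambda>\<omega>. min (R t \<omega>) (X (t + 1) \<omega> + V (t + 1) \<omega>)) \<omega>"
proof -
  interpret t: sigma_finite_subalgebra Q "F t"
    using t sigma_finite_subalgebra_F by simp
  let ?Z = "\<lambda>\<omega>. max 0 (R t \<omega> - X (t + 1) \<omega> - V (t + 1) \<omega>)"
  have "integrable Q ?Z"
    using t R_integrable[of t] X_integrable[of "t + 1"] recursive_values_integrable[OF rec, of "t + 1"]
    by simp
  then have "AE \<omega> in Q. E t (\<lambda>\<omega>. R t \<omega> - ?Z \<omega>) \<omega> = E t (R t) \<omega> - E t ?Z \<omega>"
    using t R_integrable by (intro t.real_cond_exp_diff) auto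
  moreover have "(\<lambda>\<omega>. R t \<omega> - ?Z \<omega>) = (\<lambda>\<omega>. min (R t \<omega>) (X (t + 1) \<omega> + V (t + 1) \<omega>))"
    by auto
  ultimately have "AE \<omega> in Q. E t (\<lambda>\<omega>. min (R t \<omega>) (X (t + 1) \<omega> + V (t + 1) \<omega>)) \<omega> =
      E t (R t) \<omega> - E t ?Z \<omega>"
    by simp
  moreover have "AE \<omega> in Q. E t (R t) \<omega> = R t \<omega>"
    using t R_integrable R_measurable by (intro t.real_cond_exp_F_meas) auto
  moreover have "AE \<omega> in Q. V t \<omega> = R t \<omega> - E t ?Z \<omega>"
    using rec t by (auto simp: recursive_values_def)
  ultimately show ?thesis by eventually_elim simp
qed

text \<open>Common base of the two backward inductions below: \<open>T + 1\<close> is the only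
  admissible value, so the cost is \<open>R T\<close>, which vanishes almost surely.\<close>

lemma cond_exp_terminal_cost:
  assumes "\<tau> \<in> stopping_times Q F (T + 1) (T + 1)"
  shows "AE \<omega> in Q. E T (stopped_cost R X T \<tau>) \<omega> = 0"
proof -
  interpret T: sigma_finite_subalgebra Q "F T"
    using sigma_finite_subalgebra_F by simp
  have "\<And>\<omega>. \<omega> \<in> space Q \<Longrightarrow> stopped_cost R X T \<tau> \<omega> = R T \<omega>"
    using assms by (auto simp: stopping_times_def stopped_cost_def)
  then have "AE \<omega> in Q. E T (stopped_cost R X T \<tau>) \<omega> = E T (R T) \<omega>"
    using integrable_stopped_cost[OF order_refl assms] R_integrable[of T]
    by (intro T.real_cond_exp_cong AE_I2) auto
  moreover have "AE \<omega> in Q. E T (R T) \<omega> = R T \<omega>"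
    using R_integrable R_measurable by (intro T.real_cond_exp_F_meas) auto
  ultimately show ?thesis using R_T by eventually_elim simp
qed

text \<open>Whichever branch \<open>\<tau>\<close> takes at \<open>t + 1\<close>, its conditional
  cost is at least the minimum of the two, once the induction hypothesis bounds the cost of
  continuing. Monotonicity of conditional expectation then gives the bound at
  \<open>t\<close>.\<close>

lemma recursive_values_le:
  assumes rec: "recursive_values Q F T R X C V"
    and "t \<le> T" "\<tau> \<in> stopping_times Q F (t + 1) (T + 1)"
  shows "AE \<omega> in Q. V t \<omega> \<le> E t (stopped_cost R X t \<tau>) \<omega>"
  using assms(2,3)
proof (induction t arbitrary: \<tau> rule: inc_induct)
  case base
  have "AE \<omega> in Q. V T \<omega> = 0" using rec by (simp add: recursive_values_def)
  with cond_exp_terminal_cost[OF base] show ?case by eventually_elim simp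
next
  case (step t)
  then have t: "t < T" by simp
  interpret t: sigma_finite_subalgebra Q "F t"
    using t sigma_finite_subalgebra_F by simp
  interpret t1: sigma_finite_subalgebra Q "F (t + 1)"
    using t sigma_finite_subalgebra_F by simp
  let ?\<sigma> = "\<lambda>\<omega>. max (\<tau> \<omega>) (t + 2)"
  let ?c = "E (t + 1) (stopped_cost R X (t + 1) ?\<sigma>)"
  have \<sigma>: "?\<sigma> \<in> stopping_times Q F (t + 2) (T + 1)"
    using stopping_times_max[OF step.prems, of "t + 2"] t by simp
  have eq: "\<forall>\<omega>\<in>space Q. \<tau> \<omega> \<noteq> t + 1 \<longrightarrow> ?\<sigma> \<omega> = \<tau> \<omega>"
    using step.prems by (force simp: stopping_times_def)
  have c: "integrable Q ?c"
    using integrable_stopped_cost[of "t + 1" ?\<sigma>] \<sigma> t by (intro t1.real_cond_exp_int) auto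
  have pred: "Measurable.pred Q (\<lambda>\<omega>. \<tau> \<omega> = t + 1)"
    by (rule measurable_F_Q[OF stopping_times_pred_eq[OF step.prems]]) (use t in simp_all)
  have "AE \<omega> in Q. V (t + 1) \<omega> \<le> ?c \<omega>"
    using step.IH[of ?\<sigma>] \<sigma> by simp
  then have "AE \<omega> in Q. min (R t \<omega>) (X (t + 1) \<omega> + V (t + 1) \<omega>) \<le>
      (if \<tau> \<omega> = t + 1 then R t \<omega> else X (t + 1) \<omega> + ?c \<omega>)"
    by eventually_elim auto
  then have "AE \<omega> in Q. E t (\<lambda>\<omega>. min (R t \<omega>) (X (t + 1) \<omega> + V (t + 1) \<omega>)) \<omega> \<le>
      E t (\<lambda>\<omega>. if \<tau> \<omega> = t + 1 then R t \<omega> else X (t + 1) \<omega> + ?c \<omega>) \<omega>"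
    using t R_integrable[of t] X_integrable[of "t + 1"] c pred
      recursive_values_integrable[OF rec, of "t + 1"]
    by (intro t.real_cond_exp_mono integrable_if integrable_min Bochner_Integration.integrable_add) auto
  with recursive_values_min[OF rec t] cond_exp_stopped_cost_step[OF t step.prems \<sigma> eq]
  show ?case by eventually_elim simp
qed

text \<open>The same induction with equality: the strict inequality selects \<open>R t\<close>
  exactly when it is the smaller entry. A tie leads to continuing, where both entries have the same
  value.\<close>

lemma recursive_values_optimal:
  assumes rec: "recursive_values Q F T R X C V" and "t \<le> T"
  shows "AE \<omega> in Q. V t \<omega> = E t (stopped_cost R X t (optimal_time T R X V t)) \<omega>"
  using assms(2)
proof (induction t rule: inc_induct)
  case base
  have V: "adapted F T V" "AE \<omega> in Q. V T \<omega> = 0"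
    using rec by (simp_all add: recursive_values_def)
  from cond_exp_terminal_cost[OF optimal_time_stopping[OF V(1) order_refl]] V(2)
  show ?case by eventually_elim simp
next
  case (step t)
  then have t: "t < T" by simp
  interpret t: sigma_finite_subalgebra Q "F t"
    using t sigma_finite_subalgebra_F by simp
  let ?\<tau> = "optimal_time T R X V t" and ?\<sigma> = "optimal_time T R X V (t + 1)"
  let ?c = "E (t + 1) (stopped_cost R X (t + 1) ?\<sigma>)"
  have V: "adapted F T V" using rec by (simp add: recursive_values_def)
  have \<tau>: "?\<tau> \<in> stopping_times Q F (t + 1) (T + 1)"
    using optimal_time_stopping[OF V, of t] t by simp
  have \<sigma>: "?\<sigma> \<in> stopping_times Q F (t + 2) (T + 1)"
    using optimal_time_stopping[OF V, of "t + 1"] t by simp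
  have eq: "\<forall>\<omega>\<in>space Q. ?\<tau> \<omega> \<noteq> t + 1 \<longrightarrow> ?\<sigma> \<omega> = ?\<tau> \<omega>"
    using optimal_time_step[OF t, of R X V] by auto
  \<comment> \<open>The time from \<open>t + 1\<close> is at least \<open>t + 2\<close>, so the
    value \<open>t + 1\<close> arises only from the first branch.\<close>
  have iff: "?\<tau> \<omega> = t + 1 \<longleftrightarrow> R t \<omega> - X (t + 1) \<omega> - V (t + 1) \<omega> < 0" for \<omega>
    using optimal_time_step[OF t, of R X V \<omega>] optimal_time_bounds[of "t + 1" T R X V \<omega>] t
    by auto
  have [measurable]: "Measurable.pred Q (\<lambda>\<omega>. ?\<tau> \<omega> = t + 1)"
    by (rule measurable_F_Q[OF stopping_times_pred_eq[OF \<tau>]]) (use t in simp_all)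
  have [measurable]: "R t \<in> borel_measurable Q" "X (t + 1) \<in> borel_measurable Q"
      "V (t + 1) \<in> borel_measurable Q"
    using t R_integrable[of t] X_integrable[of "t + 1"]
      recursive_values_integrable[OF rec, of "t + 1"] by auto
  have "AE \<omega> in Q. V (t + 1) \<omega> = ?c \<omega>"
    using step.IH by simp
  then have "AE \<omega> in Q. min (R t \<omega>) (X (t + 1) \<omega> + V (t + 1) \<omega>) =
      (if ?\<tau> \<omega> = t + 1 then R t \<omega> else X (t + 1) \<omega> + ?c \<omega>)"
    unfolding iff by eventually_elim auto
  then have "AE \<omega> in Q. E t (\<lambda>\<omega>. min (R t \<omega>) (X (t + 1) \<omega> + V (t + 1) \<omega>)) \<omega> =
      E t (\<lambda>\<omega>. if ?\<tau> \<omega> = t + 1 then R t \<omega> else X (t + 1) \<omega> + ?c \<omega>) \<omega>"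
    by (rule t.real_cond_exp_cong) measurable
  with recursive_values_min[OF rec t] cond_exp_stopped_cost_step[OF t \<tau> \<sigma> eq]
  show ?case by eventually_elim simp
qed

section \<open>From costs to gains\<close>

lemma cond_exp_stopped_gain:
  assumes t: "t < T" and \<tau>: "\<tau> \<in> stopping_times Q F (t + 1) (T + 1)"
  shows "AE \<omega> in Q. E t (stopped_gain R X t \<tau>) \<omega> = R t \<omega> - E t (stopped_cost R X t \<tau>) \<omega>"
proof -
  interpret t: sigma_finite_subalgebra Q "F t"
    using t sigma_finite_subalgebra_F by simp
  have gain: "\<And>\<omega>. \<omega> \<in> space Q \<Longrightarrow> stopped_gain R X t \<tau> \<omega> = R t \<omega> - stopped_cost R X t \<tau> \<omega>"
    using \<tau> by (intro stopped_gain_eq) (auto simp: stopping_times_def)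
  have int: "integrable Q (R t)" "integrable Q (stopped_cost R X t \<tau>)"
    using R_integrable integrable_stopped_cost[OF _ \<tau>] t by auto
  \<comment> \<open>Stopping times are constrained only on the space, hence so is the identity
    \<open>gain\<close>; measurability is transferred along it.\<close>
  have "stopped_gain R X t \<tau> \<in> borel_measurable Q"
    using int by (subst measurable_cong[OF gain]) auto
  then have "AE \<omega> in Q. E t (stopped_gain R X t \<tau>) \<omega> = E t (\<lambda>\<omega>. R t \<omega> - stopped_cost R X t \<tau> \<omega>) \<omega>"
    using gain int by (intro t.real_cond_exp_cong AE_I2) auto
  moreover have "AE \<omega> in Q. E t (\<lambda>\<omega>. R t \<omega> - stopped_cost R X t \<tau> \<omega>) \<omega> =
      E t (R t) \<omega> - E t (stopped_cost R X t \<tau>) \<omega>"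
    using int by (rule t.real_cond_exp_diff)
  moreover have "AE \<omega> in Q. E t (R t) \<omega> = R t \<omega>"
    using t int(1) R_measurable by (intro t.real_cond_exp_F_meas) auto
  ultimately show ?thesis by eventually_elim simp
qed

lemma recursive_values_gain:
  assumes rec: "recursive_values Q F T R X C V" and t: "t < T"
  shows "AE \<omega> in Q. C t \<omega> = R t \<omega> - V t \<omega>"
proof -
  let ?Z = "\<lambda>\<omega>. max 0 (R t \<omega> - X (t + 1) \<omega> - V (t + 1) \<omega>)"
  have "AE \<omega> in Q. C t \<omega> = E t ?Z \<omega>" "AE \<omega> in Q. V t \<omega> = R t \<omega> - E t ?Z \<omega>"
    using rec t by (auto simp: recursive_values_def)
  then show ?thesis by eventually_elim simp
qed

lemma recursive_values_optimal_gain: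
  assumes rec: "recursive_values Q F T R X C V" and t: "t < T"
  shows "AE \<omega> in Q. C t \<omega> = E t (stopped_gain R X t (optimal_time T R X V t)) \<omega>"
proof -
  have "optimal_time T R X V t \<in> stopping_times Q F (t + 1) (T + 1)"
    using rec t by (intro optimal_time_stopping) (auto simp: recursive_values_def)
  from cond_exp_stopped_gain[OF t this] recursive_values_gain[OF rec t]
    recursive_values_optimal[OF rec less_imp_le[OF t]]
  show ?thesis by eventually_elim simp
qed

section \<open>Equivalence of the recursion with the stopping problems\<close>

lemma recursive_imp_stopping_values:
  assumes rec: "recursive_values Q F T R X C V"
  shows "stopping_values Q F T R X C V"
proof -
  have ad: "adapted F T C" "adapted F T V" and
    T: "AE \<omega> in Q. C T \<omega> = 0" "AE \<omega> in Q. V T \<omega> = 0"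
    using rec by (simp_all add: recursive_values_def)
  have "is_ess_sup Q (stopping_times Q F (t + 1) (T + 1))
          (\<lambda>\<tau> \<omega>. ereal (E t (stopped_gain R X t \<tau>) \<omega>)) (\<lambda>\<omega>. ereal (C t \<omega>)) \<and>
        is_ess_inf Q (stopping_times Q F (t + 1) (T + 1))
          (\<lambda>\<tau> \<omega>. ereal (E t (stopped_cost R X t \<tau>) \<omega>)) (\<lambda>\<omega>. ereal (V t \<omega>))"
    if t: "t < T" for t
  proof
    have opt: "optimal_time T R X V t \<in> stopping_times Q F (t + 1) (T + 1)"
      using optimal_time_stopping[OF ad(2)] t by simp
    have [measurable]: "C t \<in> borel_measurable Q" "V t \<in> borel_measurable Q"
      using ad t measurable_F_Q[of "C t" t] measurable_F_Q[of "V t" t] by (auto simp: adapted_def)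
    show "is_ess_inf Q (stopping_times Q F (t + 1) (T + 1))
          (\<lambda>\<tau> \<omega>. ereal (E t (stopped_cost R X t \<tau>) \<omega>)) (\<lambda>\<omega>. ereal (V t \<omega>))"
      using opt recursive_values_le[OF rec, of t] recursive_values_optimal[OF rec, of t] t
      by (intro is_ess_inf_attained[of _ _ _ _ "optimal_time T R X V t"]) auto
    have "AE \<omega> in Q. E t (stopped_gain R X t \<tau>) \<omega> \<le> C t \<omega>"
      if "\<tau> \<in> stopping_times Q F (t + 1) (T + 1)" for \<tau>
      using recursive_values_le[OF rec less_imp_le[OF t] that] cond_exp_stopped_gain[OF t that]
        recursive_values_gain[OF rec t]
      by eventually_elim simp
    then show "is_ess_sup Q (stopping_times Q F (t + 1) (T + 1))
          (\<lambda>\<tau> \<omega>. ereal (E t (stopped_gain R X t \<tau>) \<omega>)) (\<lambda>\<omega>. ereal (C t \<omega>))"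
      using opt recursive_values_optimal_gain[OF rec t]
      by (intro is_ess_sup_attained[of _ _ _ _ "optimal_time T R X V t"]) auto
  qed
  with ad T show ?thesis unfolding stopping_values_def by blast
qed

text \<open>Fixing the versions given by \<open>real_cond_exp\<close> turns the backward recursion
  into a primitive recursion on the number of remaining dates.\<close>

lemma recursive_values_exist: "\<exists>C V. recursive_values Q F T R X C V"
proof -
  \<comment> \<open>\<open>W n\<close> is the value at date \<open>T - n\<close>. In the successor
    case the current date is \<open>t = T - Suc n\<close>, so \<open>X (T - n)\<close> and
    \<open>w\<close> play the parts of \<open>X (t + 1)\<close> and
    \<open>V (t + 1)\<close>.\<close>
  define W where "W = rec_nat (\<lambda>_. 0) (\<lambda>n w \<omega>. R (T - Suc n) \<omega> -
    E (T - Suc n) (\<lambda>\<omega>. max 0 (R (T - Suc n) \<omega> - X (T - n) \<omega> - w \<omega>)) \<omega>)"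
  define V where "V = (\<lambda>t. W (T - t))"
  define C where "C = (\<lambda>t \<omega>. if t = T then 0 else R t \<omega> - V t \<omega>)"
  have V_T: "V T = (\<lambda>_. 0)"
    by (simp add: V_def W_def)
  have V: "V t = (\<lambda>\<omega>. R t \<omega> - E t (\<lambda>\<omega>. max 0 (R t \<omega> - X (t + 1) \<omega> - V (t + 1) \<omega>)) \<omega>)"
    if "t < T" for t
  proof -
    from that have "T - t = Suc (T - (t + 1))" by simp
    then have "V t = W (Suc (T - (t + 1)))" by (simp add: V_def)
    also have "\<dots> = (\<lambda>\<omega>. R t \<omega> - E t (\<lambda>\<omega>. max 0 (R t \<omega> - X (t + 1) \<omega> - V (t + 1) \<omega>)) \<omega>)"
      using that by (simp add: V_def W_def)
    finally show ?thesis .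
  qed
  have V_meas: "V t \<in> borel_measurable (F t)" if "t \<le> T" for t
    using that V[of t] V_T R_measurable[of t] by (cases "t = T") auto
  have "C t \<in> borel_measurable (F t)" if "t \<le> T" for t
    using V_meas[OF that] R_measurable[OF that] by (simp add: C_def)
  with V_meas have "recursive_values Q F T R X C V"
    unfolding recursive_values_def adapted_def using V by (auto simp: C_def V_T)
  then show ?thesis by blast
qed

text \<open>Uniqueness of essential extrema identifies given stopping values with a constructed
  solution only up to null sets. Conditional expectation does not see such changes, so the recursion
  carries over.\<close>

lemma recursive_values_cong_AE:
  assumes rec: "recursive_values Q F T R X C V"
    and ad: "adapted F T C'" "adapted F T V'"
    and C: "\<And>t. t \<le> T \<Longrightarrow> AE \<omega> in Q. C' t \<omega> = C t \<omega>"
    and V: "\<And>t. t \<le> T \<Longrightarrow> AE \<omega> in Q. V' t \<omega> = V t \<omega>"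
  shows "recursive_values Q F T R X C' V'"
proof -
  have "(AE \<omega> in Q. C' t \<omega> = E t (\<lambda>\<omega>. max 0 (R t \<omega> - X (t + 1) \<omega> - V' (t + 1) \<omega>)) \<omega>) \<and>
      (AE \<omega> in Q. V' t \<omega> = R t \<omega> - E t (\<lambda>\<omega>. max 0 (R t \<omega> - X (t + 1) \<omega> - V' (t + 1) \<omega>)) \<omega>)"
    if t: "t < T" for t
  proof -
    interpret t: sigma_finite_subalgebra Q "F t"
      using t sigma_finite_subalgebra_F by simp
    let ?Z = "\<lambda>V \<omega>. max 0 (R t \<omega> - X (t + 1) \<omega> - V (t + 1) \<omega>)"
    have [measurable]: "R t \<in> borel_measurable Q" "X (t + 1) \<in> borel_measurable Q"
        "V (t + 1) \<in> borel_measurable Q" "V' (t + 1) \<in> borel_measurable Q"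
      using t R_integrable[of t] X_integrable[of "t + 1"] ad(2) measurable_F_Q[of "V' (t + 1)" "t + 1"]
        recursive_values_integrable[OF rec, of "t + 1"] by (auto simp: adapted_def)
    have "AE \<omega> in Q. ?Z V' \<omega> = ?Z V \<omega>"
      using V[of "t + 1"] t by auto
    then have Z: "AE \<omega> in Q. E t (?Z V') \<omega> = E t (?Z V) \<omega>"
      by (rule t.real_cond_exp_cong) measurable
    have "AE \<omega> in Q. C t \<omega> = E t (?Z V) \<omega>" "AE \<omega> in Q. V t \<omega> = R t \<omega> - E t (?Z V) \<omega>"
      using rec t by (auto simp: recursive_values_def)
    with Z C[of t] V[of t] t show ?thesis by auto
  qed
  moreover have "AE \<omega> in Q. C T \<omega> = 0" "AE \<omega> in Q. V T \<omega> = 0"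
    using rec by (simp_all add: recursive_values_def)
  then have "AE \<omega> in Q. C' T \<omega> = 0" "AE \<omega> in Q. V' T \<omega> = 0"
    using C[of T] V[of T] by auto
  ultimately show ?thesis unfolding recursive_values_def using ad by blast
qed

lemma stopping_values_unique:
  assumes "stopping_values Q F T R X C V" "stopping_values Q F T R X C' V'" "t \<le> T"
  shows "AE \<omega> in Q. C t \<omega> = C' t \<omega>" "AE \<omega> in Q. V t \<omega> = V' t \<omega>"
proof -
  have "(AE \<omega> in Q. C t \<omega> = C' t \<omega>) \<and> (AE \<omega> in Q. V t \<omega> = V' t \<omega>)"
  proof (cases "t = T")
    case True
    then show ?thesis using assms(1,2) unfolding stopping_values_def by auto
  next
    case False
    with assms have "t < T" by simp
    with assms(1,2) have
      "AE \<omega> in Q. ereal (C t \<omega>) = ereal (C' t \<omega>)" "AE \<omega> in Q. ereal (V t \<omega>) = ereal (V' t \<omega>)"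
      unfolding stopping_values_def
      by - (rule is_ess_sup_unique, blast, blast, rule is_ess_inf_unique, blast, blast)
    then show ?thesis by simp
  qed
  then show "AE \<omega> in Q. C t \<omega> = C' t \<omega>" "AE \<omega> in Q. V t \<omega> = V' t \<omega>" by auto
qed

lemma stopping_imp_recursive_values:
  assumes "stopping_values Q F T R X C V"
  shows "recursive_values Q F T R X C V"
proof -
  obtain C' V' where rec: "recursive_values Q F T R X C' V'"
    using recursive_values_exist by blast
  from assms show ?thesis
    using stopping_values_unique[OF assms recursive_imp_stopping_values[OF rec]]
    by (intro recursive_values_cong_AE[OF rec]) (auto simp: stopping_values_def)
qed

lemma recursive_values_L1:
  assumes rec: "recursive_values Q F T R X C V" and t: "t \<le> T"
  shows "C t \<in> L1 Q (F t)" "V t \<in> L1 Q (F t)"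
proof -
  have meas: "C t \<in> borel_measurable (F t)" "V t \<in> borel_measurable (F t)"
    using rec t by (auto simp: recursive_values_def adapted_def)
  have V: "integrable Q (V t)" by (rule recursive_values_integrable[OF rec t])
  \<comment> \<open>The date \<open>T\<close> is treated apart: there \<open>C\<close> is given by
    its terminal condition, and the relation between \<open>C\<close> and \<open>V\<close> comes
    from the recursion at earlier dates.\<close>
  have "AE \<omega> in Q. C t \<omega> = (if t = T then 0 else R t \<omega> - V t \<omega>)"
    using rec recursive_values_gain[OF rec, of t] t
    by (cases "t = T") (auto simp: recursive_values_def)
  moreover have "integrable Q (\<lambda>\<omega>. if t = T then 0 else R t \<omega> - V t \<omega>)"
    using V R_integrable[OF t] by (cases "t = T") simp_all
  ultimately have "integrable Q (C t)"
    using measurable_F_Q[OF meas(1) t] by (subst integrable_cong_AE) auto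
  with meas V show "C t \<in> L1 Q (F t)" "V t \<in> L1 Q (F t)"
    using L1_iff[OF subalgebra_F[OF t]] by auto
qed

end

section \<open>Change of measure and conclusion\<close>

theorem theorem1:
  fixes P Q :: "'a measure" and F :: "nat \<Rightarrow> 'a measure" and T :: nat
    and D Xo Xr R X :: "nat \<Rightarrow> 'a \<Rightarrow> real"
  assumes "T \<ge> 1"
    and "filtered_prob_space P F T"
    and "is_martingale P F T D"
    and "\<forall>t\<le>T. AE \<omega> in P. D t \<omega> > 0"
    and "(\<integral>\<omega>. D T \<omega> \<partial>P) = 1"
    and "Q = density P (\<lambda>\<omega>. ennreal (D T \<omega>))"
    and "\<forall>t\<in>{1..T}. Xo t \<in> L1 Q (F t) \<and> Xr t \<in> L1 Q (F t)"
    and "\<forall>t\<le>T. R t \<in> L1 Q (F t)"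
    and "AE \<omega> in Q. R T \<omega> = 0"
    and "X = (\<lambda>t \<omega>. Xo t \<omega> - Xr t \<omega>)"
  shows
    "((\<exists>C V. stopping_values Q F T R X C V) \<and>
      (\<forall>C V. stopping_values Q F T R X C V \<longrightarrow>
         (\<forall>t\<le>T. C t \<in> L1 Q (F t) \<and> V t \<in> L1 Q (F t)) \<and>
         recursive_values Q F T R X C V)) \<and>
     (\<forall>C V. stopping_values Q F T R X C V \<longrightarrow>
        (\<forall>t<T.
           optimal_time T R X V t \<in> stopping_times Q F (t + 1) (T + 1) \<and>
           (AE \<omega> in Q. C t \<omega> =
              real_cond_exp Q (F t) (stopped_gain R X t (optimal_time T R X V t)) \<omega>) \<and>
           (AE \<omega> in Q. V t \<omega> =
              real_cond_exp Q (F t) (stopped_cost R X t (optimal_time T R X V t)) \<omega>))) \<and>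
     (\<forall>C V. recursive_values Q F T R X C V \<longrightarrow> stopping_values Q F T R X C V)"
proof -
  interpret P: filtered_prob_space P F T by fact
  have D: "D T \<in> borel_measurable P" "integrable P (D T)"
    using assms(3) L1_iff[OF P.subalgebra_F[OF order_refl]]
      measurable_from_subalg[OF P.subalgebra_F[OF order_refl]]
    by (auto simp: is_martingale_def)
  have "AE \<omega> in P. 0 \<le> D T \<omega>"
    using assms(4) by (auto intro: AE_mp)
  \<comment> \<open>\<open>ennreal\<close> cuts negative values off at 0. Since \<open>D T\<close>
    is almost surely nonnegative, the mass of \<open>Q\<close> is the integral of
    \<open>D T\<close>, which is 1.\<close>
  then have "(\<integral>\<^sup>+\<omega>. ennreal (D T \<omega>) \<partial>P) = 1"
    using D assms(5) by (subst nn_integral_eq_integral) auto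
  then have "emeasure Q (space Q) = 1"
    using D by (simp add: assms(6) emeasure_density cong: nn_integral_cong)
  then have "prob_space Q" by (rule prob_spaceI)
  \<comment> \<open>A density measure keeps the space and the measurable sets of \<open>P\<close>,
    so the filtration is also one for \<open>Q\<close>.\<close>
  moreover have sub: "subalgebra Q (F t)" if "t \<le> T" for t
    using P.subalgebra_F[OF that] by (simp add: subalgebra_def assms(6))
  have "X t \<in> L1 Q (F t)" if "t \<in> {1..T}" for t
    using bspec[OF assms(7) that] that L1_iff[OF sub, of t] by (simp add: assms(10) borel_measurable_diff)
  ultimately interpret optimal_stopping Q F T R X
    using sub P.sets_F_mono assms(8,9)
    by (simp add: optimal_stopping_def optimal_stopping_axioms_def)
  have "\<exists>C V. stopping_values Q F T R X C V"
    using recursive_values_exist recursive_imp_stopping_values by blast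
  moreover have "(\<forall>t\<le>T. C t \<in> L1 Q (F t) \<and> V t \<in> L1 Q (F t)) \<and> recursive_values Q F T R X C V"
    if "stopping_values Q F T R X C V" for C V
    using stopping_imp_recursive_values[OF that] recursive_values_L1 by blast
  moreover have "\<forall>t<T. optimal_time T R X V t \<in> stopping_times Q F (t + 1) (T + 1) \<and>
      (AE \<omega> in Q. C t \<omega> = E t (stopped_gain R X t (optimal_time T R X V t)) \<omega>) \<and>
      (AE \<omega> in Q. V t \<omega> = E t (stopped_cost R X t (optimal_time T R X V t)) \<omega>)"
    if "stopping_values Q F T R X C V" for C V
  proof (intro allI impI conjI)
    fix t assume t: "t < T"
    note rec = stopping_imp_recursive_values[OF that]
    show "optimal_time T R X V t \<in> stopping_times Q F (t + 1) (T + 1)"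
      using that t by (intro optimal_time_stopping) (auto simp: stopping_values_def)
    show "AE \<omega> in Q. C t \<omega> = E t (stopped_gain R X t (optimal_time T R X V t)) \<omega>"
      by (rule recursive_values_optimal_gain[OF rec t])
    show "AE \<omega> in Q. V t \<omega> = E t (stopped_cost R X t (optimal_time T R X V t)) \<omega>"
      by (rule recursive_values_optimal[OF rec less_imp_le[OF t]])
  qed
  ultimately show ?thesis using recursive_imp_stopping_values by blast
qed

end
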